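(* Let $n\in\mathbb N$ and $d\in(0,n)$. Let $\mu$ be the $d$-dimensional Minkowski content measure on $S\in\mathcal M$, where $\mathcal M$ is the family of subsets of $\mathbb R^n$ that can be expressed as the intersection of an open set with a closed set. Let $F\subset\mathbb R^n$ be closed and $G\subset\mathbb R^n$ be open. Suppose $\mu(\partial_S(S\cap F))=0$. Let $S'=S\cap F\cap G$ and $\mu'=\mu|_{S'}$. Then $\mu'$ is the $d$-dimensional Minkowski content measure on $S'$.
   Context: $\lambda^n$ is Lebesgue measure on $\mathbb R^n$. For $S\subset\mathbb R^n$ and $r>0$, $B(S,r)=\{x\in\mathbb R^n:\mathrm{dist}(x,S)\le r\}$ and $\mathrm{Cont}(S;r)=r^{d-n}\lambda^n(B(S,r))$; the $d$-dimensional Minkowski content is $\mathrm{Cont}_d(S)=\lim_{r\to0^+}\mathrm{Cont}(S;r)$ when the limit exists. For $T\subset S\subset\mathbb R^n$, $\partial_ST=S\cap\overline T\cap\overline{S\setminus T}$ is the relative boundary of $T$ in $S$. For $S\in\mathcal M$, a $d$-dimensional Minkowski content measure on $S$ is a Borel measure $\mu$ on $S$ such that for every compact $K\subset S$: (i) $\mu(K)<\infty$, and (ii) whenever $\mu(\partial_SK)=0$, $\mathrm{Cont}_d(K)$ exists and equals $\mu(K)$. It is unique when it exists. *)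

theory Defs
  imports "HOL-Analysis.Analysis"
begin

definition loc_closed_sets :: "(real ^ 'n) set set" where
  "loc_closed_sets = {U \<inter> C |U C. open U \<and> closed C}"

(* The distance to the empty set is infinite, so the neighbourhood of {} is empty;
   the case needs to be singled out because infdist x {} = 0. *)
definition nbhd :: "(real ^ 'n) set \<Rightarrow> real \<Rightarrow> (real ^ 'n) set" where
  "nbhd S r = {x. S \<noteq> {} \<and> infdist x S \<le> r}"

definition mink_cont :: "real \<Rightarrow> (real ^ 'n) set \<Rightarrow> real \<Rightarrow> ennreal" where
  "mink_cont d S r = ennreal (r powr (d - real CARD('n))) * emeasure lebesgue (nbhd S r)"

(* The limit defining the d-dimensional Minkowski content of S exists and is c. *)
definition has_minkowski_content :: "real \<Rightarrow> (real ^ 'n) set \<Rightarrow> ennreal \<Rightarrow> bool" where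
  "has_minkowski_content d S c \<longleftrightarrow> (mink_cont d S \<longlongrightarrow> c) (at_right 0)"

definition rel_boundary :: "(real ^ 'n) set \<Rightarrow> (real ^ 'n) set \<Rightarrow> (real ^ 'n) set" where
  "rel_boundary S T = S \<inter> closure T \<inter> closure (S - T)"

(* The second conjunct says that \<mu> is a Borel measure on S (so space \<mu> = S). *)
definition minkowski_content_measure ::
    "real \<Rightarrow> (real ^ 'n) set \<Rightarrow> (real ^ 'n) measure \<Rightarrow> bool" where
  "minkowski_content_measure d S \<mu> \<longleftrightarrow>
     S \<in> loc_closed_sets \<and>
     sets \<mu> = sets (restrict_space borel S) \<and>
     (\<forall>K. compact K \<and> K \<subseteq> S \<longrightarrow>
        emeasure \<mu> K < \<infinity> \<and>
        (emeasure \<mu> (rel_boundary S K) = 0 \<longrightarrow> has_minkowski_content d K (emeasure \<mu> K)))"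

lemma loc_closed_nbhd_compact:
  assumes "S \<in> loc_closed_sets" "compact K" "K \<subseteq> S" "K \<noteq> {}"
  obtains e where "e > 0" "\<And>r. r \<le> e \<Longrightarrow> compact {x \<in> S. infdist x K \<le> r}"
proof -
  obtain U C where UC: "open U" "closed C" "S = U \<inter> C"
    using assms(1) by (auto simp: loc_closed_sets_def)
  obtain e where e: "e > 0" "(\<Union>x\<in>K. cball x e) \<subseteq> U"
    using compact_subset_open_imp_cball_epsilon_subset[of K U] assms UC by auto
  have inU: "x \<in> U" if "infdist x K \<le> e" for x
  proof -
    obtain y where "y \<in> K" "infdist x K = dist x y"
      using infdist_attains_inf[of K x] assms compact_imp_closed by metis
    then have "x \<in> cball y e" using that by (simp add: dist_commute)
    with e(2) \<open>y \<in> K\<close> show ?thesis by blast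
  qed
  have "compact {x \<in> S. infdist x K \<le> r}" if "r \<le> e" for r
  proof -
    have eq: "{x \<in> S. infdist x K \<le> r} = C \<inter> {x. infdist x K \<le> r}"
      using inU that UC by auto
    obtain B where B: "\<And>y. y \<in> K \<Longrightarrow> norm y \<le> B"
      using compact_imp_bounded[OF assms(2)] by (auto simp: bounded_iff)
    have "norm x \<le> B + r" if "infdist x K \<le> r" for x
    proof -
      obtain y where y: "y \<in> K" "infdist x K = dist x y"
        using infdist_attains_inf[of K x] assms compact_imp_closed by metis
      have "norm x \<le> norm y + dist x y"
        by (metis dist_norm norm_triangle_sub)
      then show ?thesis using y B[of y] that by auto
    qed
    then have "bounded {x. infdist x K \<le> r}"
      by (auto simp: bounded_iff)
    moreover have "closed {x. infdist x K \<le> r}"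
      by (intro closed_Collect_le continuous_intros)
    ultimately show ?thesis
      unfolding eq using UC(2) by (auto simp: compact_eq_bounded_closed intro: bounded_subset)
  qed
  with e that show ?thesis by blast
qed

lemma minkowski_content_measure_sets:
  assumes "minkowski_content_measure d S \<mu>"
  shows "A \<in> sets \<mu> \<longleftrightarrow> A \<in> sets borel \<and> A \<subseteq> S"
proof -
  have "S \<in> sets borel"
    using assms by (auto simp: minkowski_content_measure_def loc_closed_sets_def)
  then show ?thesis
    using assms by (auto simp: minkowski_content_measure_def sets_restrict_space_iff)
qed

lemma minkowski_content_measure_finite:
  assumes "minkowski_content_measure d S \<mu>" "compact K" "K \<subseteq> S"
  shows "emeasure \<mu> K < \<infinity>"
  using assms by (auto simp: minkowski_content_measure_def)

lemma minkowski_content_measure_countable: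
  assumes "minkowski_content_measure d S \<mu>" "compact {x \<in> S. infdist x K \<le> e}"
  shows "countable {r. r \<le> e \<and> emeasure \<mu> {x \<in> S. infdist x K = r} \<noteq> 0}"
proof -
  define A where "A = {x \<in> S. infdist x K \<le> e}"
  have A: "A \<in> sets \<mu>" "emeasure \<mu> A < \<infinity>"
    using borel_compact[OF assms(2)] assms minkowski_content_measure_finite[OF assms(1), of A]
    by (auto simp: A_def minkowski_content_measure_sets[OF assms(1)])
  have sp: "space \<mu> = S"
    using assms sets_eq_imp_space_eq[of \<mu> "restrict_space borel S"]
    by (simp add: minkowski_content_measure_def space_restrict_space)
  have sets_A: "sets (restrict_space \<mu> A) = sets (restrict_space borel A)"
    using A minkowski_content_measure_sets[OF assms(1)] assms
    by (auto simp: set_eq_iff sets_restrict_space_iff A_def)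
  have meas: "(\<lambda>x. infdist x K) \<in> restrict_space \<mu> A \<rightarrow>\<^sub>M borel"
    unfolding measurable_cong_sets[OF sets_A refl]
    by (intro measurable_restrict_space1) (intro borel_measurable_continuous_onI continuous_intros)
  define N where "N = distr (restrict_space \<mu> A) borel (\<lambda>x. infdist x K)"
  interpret finite_measure N
  proof
    have "emeasure N (space N) = emeasure \<mu> A"
      using A meas sp sets.sets_into_space[OF A(1)]
      by (subst N_def, subst emeasure_distr)
         (auto simp: N_def space_restrict_space emeasure_restrict_space Int_absorb1 Int_absorb2)
    then show "emeasure N (space N) \<noteq> \<infinity>" using A by auto
  qed
  have "emeasure N {r} = emeasure \<mu> {x \<in> S. infdist x K = r}" if "r \<le> e" for r
  proof -
    have "(\<lambda>x. infdist x K) -` {r} \<inter> space (restrict_space \<mu> A) = {x \<in> S. infdist x K = r}"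
      using that sp by (auto simp: space_restrict_space A_def)
    moreover have "{x \<in> S. infdist x K = r} \<subseteq> A" using that by (auto simp: A_def)
    ultimately show ?thesis
      using A meas sets.sets_into_space[OF A(1)]
      by (auto simp: N_def emeasure_distr emeasure_restrict_space Int_absorb2)
  qed
  then have "{r. r \<le> e \<and> emeasure \<mu> {x \<in> S. infdist x K = r} \<noteq> 0} \<subseteq> {r. measure N {r} \<noteq> 0}"
    by (auto simp flip: emeasure_eq_measure simp: measure_def enn2real_eq_0_iff)
  then show ?thesis using countable_support countable_subset by blast
qed

lemma minkowski_content_measure_le:
  assumes "minkowski_content_measure d S \<mu>" "minkowski_content_measure d S \<nu>"
    and "compact K" "K \<subseteq> S"
  shows "emeasure \<mu> K \<le> emeasure \<nu> K"
proof (cases "K = {}")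
  case False
  have S: "S \<in> loc_closed_sets"
    using assms(1) by (simp add: minkowski_content_measure_def)
  obtain e where e: "e > 0" "\<And>r. r \<le> e \<Longrightarrow> compact {x \<in> S. infdist x K \<le> r}"
    using loc_closed_nbhd_compact[OF S assms(3,4) False] by blast
  define A where "A r = {x \<in> S. infdist x K \<le> r}" for r
  have cA: "compact (A r)" if "r \<le> e" for r using e that by (auto simp: A_def)
  have mA: "A r \<in> sets \<mu>" "A r \<in> sets \<nu>" if "r \<le> e" for r
    using borel_compact[OF cA[OF that]] assms by (auto simp: minkowski_content_measure_sets A_def)
  have bd: "rel_boundary S (A r) \<subseteq> {x \<in> S. infdist x K = r}" for r
  proof -
    have "closure (A r) \<subseteq> {x. infdist x K \<le> r}"
      by (intro closure_minimal closed_Collect_le continuous_intros) (auto simp: A_def)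
    moreover have "closure (S - A r) \<subseteq> {x. r \<le> infdist x K}"
      by (intro closure_minimal closed_Collect_le continuous_intros) (auto simp: A_def)
    ultimately show ?thesis by (auto simp: rel_boundary_def intro!: antisym)
  qed
  have L: "{x \<in> S. infdist x K = r} \<in> sets borel" for r
  proof -
    have "S \<in> sets borel" using S by (auto simp: loc_closed_sets_def)
    moreover have "closed {x. infdist x K = r}"
      by (intro closed_Collect_eq continuous_intros)
    ultimately have "S \<inter> {x. infdist x K = r} \<in> sets borel" by auto
    then show ?thesis by (simp add: Collect_conj_eq)
  qed
  define Bad where "Bad = {r. r \<le> e \<and> emeasure \<mu> {x \<in> S. infdist x K = r} \<noteq> 0}
     \<union> {r. r \<le> e \<and> emeasure \<nu> {x \<in> S. infdist x K = r} \<noteq> 0}"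
  have Bad: "countable Bad"
    unfolding Bad_def
    using minkowski_content_measure_countable[OF assms(1) e(2)[OF order_refl]]
          minkowski_content_measure_countable[OF assms(2) e(2)[OF order_refl]] by blast
  have le: "emeasure \<mu> K \<le> emeasure \<nu> (A s)" if s: "0 < s" "s \<le> e" for s
  proof -
    have "uncountable {0<..<s}" using s by (simp add: uncountable_open_interval)
    then obtain r where r: "0 < r" "r < s" "r \<notin> Bad"
      using countable_subset[OF _ Bad, of "{0<..<s}"] by (meson greaterThanLessThan_iff subsetI)
    have zero: "emeasure \<mu> (rel_boundary S (A r)) = 0" "emeasure \<nu> (rel_boundary S (A r)) = 0"
    proof -
      have "emeasure \<mu> {x \<in> S. infdist x K = r} = 0" "emeasure \<nu> {x \<in> S. infdist x K = r} = 0"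
        using r s by (auto simp: Bad_def)
      moreover have "{x \<in> S. infdist x K = r} \<in> sets \<mu>" "{x \<in> S. infdist x K = r} \<in> sets \<nu>"
        using L assms(1,2) by (auto simp: minkowski_content_measure_sets)
      ultimately show "emeasure \<mu> (rel_boundary S (A r)) = 0" "emeasure \<nu> (rel_boundary S (A r)) = 0"
        using emeasure_mono[OF bd[of r], of \<mu>] emeasure_mono[OF bd[of r], of \<nu>] by simp_all
    qed
    have "A r \<subseteq> S" by (auto simp: A_def)
    then have "has_minkowski_content d (A r) (emeasure \<mu> (A r))"
              "has_minkowski_content d (A r) (emeasure \<nu> (A r))"
      using assms(1,2) cA[of r] r s zero by (auto simp: minkowski_content_measure_def)
    then have "emeasure \<mu> (A r) = emeasure \<nu> (A r)"
      unfolding has_minkowski_content_def by (meson tendsto_unique trivial_limit_at_right_real)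
    moreover have "K \<subseteq> A r" using assms(4) r by (auto simp: A_def)
    moreover have "A r \<subseteq> A s" using r by (auto simp: A_def)
    moreover have "A r \<in> sets \<mu>" "A s \<in> sets \<nu>" using mA r s by auto
    ultimately show ?thesis
      using order_trans[OF emeasure_mono[of K "A r" \<mu>], of "emeasure \<nu> (A s)"]
        emeasure_mono[of "A r" "A s" \<nu>] by simp
  qed
  define B where "B k = A (e / real (Suc k))" for k
  have ek: "0 < e / real (Suc k)" "e / real (Suc k) \<le> e" for k
    using e by (auto simp: field_simps)
  have lim: "(\<lambda>k. emeasure \<nu> (B k)) \<longlonglongrightarrow> emeasure \<nu> (\<Inter>k. B k)"
  proof (rule Lim_emeasure_decseq)
    show "range B \<subseteq> sets \<nu>" using mA ek by (auto simp: B_def)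
    have mono: "e / real (Suc n) \<le> e / real (Suc m)" if "m \<le> n" for m n
      using e that by (intro divide_left_mono) auto
    show "decseq B" using mono by (auto simp: decseq_def B_def A_def intro: order_trans)
    show "emeasure \<nu> (B i) \<noteq> \<infinity>" for i
      using minkowski_content_measure_finite[OF assms(2) cA[OF ek(2)[of i]]]
      by (auto simp: B_def A_def)
  qed
  have "(\<Inter>k. B k) = K"
  proof
    show "K \<subseteq> (\<Inter>k. B k)" using assms(4) e by (auto simp: B_def A_def)
    show "(\<Inter>k. B k) \<subseteq> K"
    proof
      fix x assume x: "x \<in> (\<Inter>k. B k)"
      have "infdist x K \<le> e / real (Suc k)" for k using x by (auto simp: B_def A_def)
      moreover have "(\<lambda>k. e / real (Suc k)) \<longlonglongrightarrow> 0"
        using tendsto_mult_right_zero[OF LIMSEQ_inverse_real_of_nat, of e]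
        by (simp add: divide_inverse)
      ultimately have "infdist x K \<le> 0"
        by (meson LIMSEQ_le_const)
      then show "x \<in> K"
        using infdist_nonneg[of x K]
          in_closed_iff_infdist_zero[OF compact_imp_closed[OF assms(3)] False, of x] by linarith
    qed
  qed
  with lim have "(\<lambda>k. emeasure \<nu> (B k)) \<longlonglongrightarrow> emeasure \<nu> K" by simp
  then show ?thesis
    by (rule LIMSEQ_le_const) (use le ek in \<open>auto simp: B_def\<close>)
qed auto

(* Justifies speaking of THE d-dimensional Minkowski content measure on S. *)
lemma minkowski_content_measure_unique:
  fixes S :: "(real ^ 'n) set"
  assumes "minkowski_content_measure d S \<mu>" "minkowski_content_measure d S \<nu>"
  shows "\<mu> = \<nu>"
proof -
  obtain U C where UC: "open U" "closed C" "S = U \<inter> C"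
    using assms(1) by (auto simp: minkowski_content_measure_def loc_closed_sets_def)
  obtain D :: "nat \<Rightarrow> (real ^ 'n) set" where D: "\<And>n. compact (D n)" "\<Union>(range D) = U"
    by (rule open_Union_compact_subsets[OF UC(1)]) blast
  define E where "E = {K. compact K \<and> K \<subseteq> S}"
  define A where "A k = D k \<inter> C" for k
  have A: "range A \<subseteq> E" "(\<Union>i. A i) = S"
    using D UC by (auto simp: A_def E_def compact_Int_closed)
  have borS: "S \<in> sigma_sets UNIV (Collect closed)"
  proof -
    have "S \<in> sets borel" using UC by auto
    then show ?thesis by (simp add: borel_eq_closed)
  qed
  have "sets (restrict_space borel S) = sigma_sets S ((\<inter>) S ` Collect closed)"
    using sigma_sets_Int[OF borS] by (simp add: sets_restrict_space borel_eq_closed)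
  also have "\<dots> = sigma_sets S E"
  proof (rule sigma_sets_eqI)
    fix T assume "T \<in> (\<inter>) S ` Collect closed"
    then obtain W where W: "closed W" "T = S \<inter> W" by auto
    have "A i \<inter> W \<in> E" for i using A W by (auto simp: E_def compact_Int_closed)
    then have "(\<Union>i. A i \<inter> W) \<in> sigma_sets S E" by (intro sigma_sets.Union) auto
    moreover have "(\<Union>i. A i \<inter> W) = T" using A W by auto
    ultimately show "T \<in> sigma_sets S E" by simp
  next
    fix K assume "K \<in> E"
    then have "closed K" "K = S \<inter> K" by (auto simp: E_def compact_imp_closed)
    then show "K \<in> sigma_sets S ((\<inter>) S ` Collect closed)" by blast
  qed
  finally have gen: "sets (restrict_space borel S) = sigma_sets S E" .
  show ?thesis
  proof (rule measure_eqI_generator_eq[where \<Omega> = S and E = E and A = A])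
    show "Int_stable E" by (auto simp: E_def Int_stable_def compact_Int)
    show "E \<subseteq> Pow S" by (auto simp: E_def)
    show "emeasure \<mu> X = emeasure \<nu> X" if "X \<in> E" for X
      using that assms minkowski_content_measure_le by (auto simp: E_def intro!: antisym)
    show "sets \<mu> = sigma_sets S E" "sets \<nu> = sigma_sets S E"
      using assms gen by (auto simp: minkowski_content_measure_def)
    show "range A \<subseteq> E" "(\<Union>i. A i) = S" by fact+
    show "emeasure \<mu> (A i) \<noteq> \<infinity>" for i
    proof -
      have "A i \<in> E" using A(1) by blast
      then show ?thesis
        using minkowski_content_measure_finite[OF assms(1), of "A i"] by (auto simp: E_def)
    qed
  qed
qed

end

theory Submission
  imports Defs
begin

text \<open>
  Write \<open>\<partial>\<^sub>S T\<close> for the relative boundary. Minkowski contents of compact sets do not refer to an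
  ambient set, so the content condition for a compact \<open>K \<subseteq> S'\<close> with respect to \<open>S'\<close> differs from the
  one with respect to \<open>S\<close> only in its hypothesis: \<open>\<partial>\<^bsub>S'\<^esub> K\<close> instead of \<open>\<partial>\<^sub>S K\<close> is known to be null.
  A point of \<open>\<partial>\<^sub>S K\<close> outside \<open>\<partial>\<^bsub>S'\<^esub> K\<close> is a point of \<open>K\<close> approximated from \<open>S - S'\<close>. Since \<open>K\<close> lies
  in the open set \<open>G\<close>, it is not approximated from outside \<open>G\<close>, hence it is approximated from
  \<open>S - F\<close>; as it lies in \<open>S \<inter> F\<close> itself, it belongs to \<open>\<partial>\<^sub>S (S \<inter> F)\<close>, which is null by hypothesis.
  So \<open>\<partial>\<^sub>S K\<close> is null as well, and the content condition for \<open>\<mu>\<close> applies to \<open>K\<close>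
  (\<open>rel_boundary_subset_restrict\<close>).
\<close>

lemma loc_closed_sets_Int_closed_open:
  assumes "S \<in> loc_closed_sets" "closed F" "open G"
  shows "S \<inter> F \<inter> G \<in> loc_closed_sets"
proof -
  obtain U C where "open U" "closed C" "S = U \<inter> C"
    using assms(1) by (auto simp: loc_closed_sets_def)
  moreover from this have "S \<inter> F \<inter> G = (U \<inter> G) \<inter> (C \<inter> F)" by blast
  ultimately show ?thesis
    using assms(2,3) unfolding loc_closed_sets_def by blast
qed

lemma rel_boundary_borel:
  assumes "S \<in> sets borel"
  shows "rel_boundary S T \<in> sets borel"
  using assms by (auto simp: rel_boundary_def)

text \<open>
  Shrinking the ambient set can only remove boundary points of \<open>K\<close>; those lost here lie on the
  boundary of the closed piece \<open>S \<inter> F\<close>, because cutting down to an open neighbourhood of \<open>K\<close> does not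
  change the local picture at points of \<open>K\<close>.
\<close>

lemma rel_boundary_subset_restrict:
  assumes "closed K" "open G" "K \<subseteq> S \<inter> F \<inter> G"
  shows "rel_boundary S K \<subseteq> rel_boundary (S \<inter> F \<inter> G) K \<union> rel_boundary S (S \<inter> F)"
proof
  fix x assume x: "x \<in> rel_boundary S K"
  then have xK: "x \<in> K" and "x \<in> closure (S - K)"
    using assms(1) by (auto simp: rel_boundary_def)
  moreover have "S - K \<subseteq> (S \<inter> F \<inter> G - K) \<union> (S - S \<inter> F) \<union> - G"
    by blast
  ultimately have "x \<in> closure (S \<inter> F \<inter> G - K) \<union> closure (S - S \<inter> F) \<union> closure (- G)"
    using closure_mono by (metis closure_Un subsetD)
  moreover have "x \<notin> closure (- G)"
    using xK assms(2,3) by (auto simp: closure_closed closed_Compl)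
  moreover have "x \<in> closure K" "x \<in> closure (S \<inter> F)"
    using xK assms(3) closure_subset by blast+
  ultimately show "x \<in> rel_boundary (S \<inter> F \<inter> G) K \<union> rel_boundary S (S \<inter> F)"
    using xK assms(3) by (auto simp: rel_boundary_def)
qed

theorem theorem6p12:
  fixes d :: real and S F G S' :: "(real ^ 'n) set" and \<mu> \<mu>' :: "(real ^ 'n) measure"
  assumes "0 < d" and "d < real CARD('n)"
    and "S \<in> loc_closed_sets"
    and "minkowski_content_measure d S \<mu>"
    and "closed F" and "open G"
    and "emeasure \<mu> (rel_boundary S (S \<inter> F)) = 0"
    and "S' = S \<inter> F \<inter> G" and "\<mu>' = restrict_space \<mu> S'"
  shows "minkowski_content_measure d S' \<mu>'"
proof -
  note sets_\<mu> = minkowski_content_measure_sets[OF assms(4)]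
  have S': "S' \<in> loc_closed_sets"
    using loc_closed_sets_Int_closed_open assms(3,5,6,8) by blast
  have borel: "S \<in> sets borel" "S' \<in> sets borel"
    using assms(3) S' by (auto simp: loc_closed_sets_def)
  have sub: "S' \<subseteq> S" using assms(8) by blast
  have space: "space \<mu> = S"
    using assms(4) sets_eq_imp_space_eq[of \<mu> "restrict_space borel S"]
    by (simp add: minkowski_content_measure_def space_restrict_space)
  have S'_meas: "S' \<inter> space \<mu> \<in> sets \<mu>"
    using borel sub by (auto simp: sets_\<mu> space)
  have sets': "sets \<mu>' = sets (restrict_space borel S')"
    using S'_meas borel sub
    by (auto simp: assms(9) set_eq_iff sets_restrict_space_iff sets_\<mu> space)
  have em: "emeasure \<mu>' A = emeasure \<mu> A" if "A \<subseteq> S'" for A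
    using emeasure_restrict_space[OF S'_meas that] by (simp add: assms(9))
  have "emeasure \<mu>' K < \<infinity> \<and>
      (emeasure \<mu>' (rel_boundary S' K) = 0 \<longrightarrow> has_minkowski_content d K (emeasure \<mu>' K))"
    if K: "compact K" "K \<subseteq> S'" for K
  proof (intro conjI impI)
    have KS: "K \<subseteq> S" using K(2) sub by blast
    show "emeasure \<mu>' K < \<infinity>"
      using minkowski_content_measure_finite[OF assms(4) K(1) KS] em[OF K(2)] by simp
    assume null: "emeasure \<mu>' (rel_boundary S' K) = 0"
    have bd': "rel_boundary S' K \<subseteq> S'" and bd: "rel_boundary S (S \<inter> F) \<subseteq> S"
      by (auto simp: rel_boundary_def)
    have "rel_boundary S' K \<in> null_sets \<mu>" "rel_boundary S (S \<inter> F) \<in> null_sets \<mu>"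
      using null em[OF bd'] assms(7) bd bd' sub borel
      by (auto simp: null_sets_def sets_\<mu> intro!: rel_boundary_borel)
    then have "rel_boundary S' K \<union> rel_boundary S (S \<inter> F) \<in> null_sets \<mu>"
      by (rule null_sets.Un)
    moreover have "rel_boundary S K \<subseteq> rel_boundary S' K \<union> rel_boundary S (S \<inter> F)"
      using rel_boundary_subset_restrict[OF compact_imp_closed[OF K(1)] assms(6)] K(2) assms(8)
      by blast
    ultimately have "emeasure \<mu> (rel_boundary S K) = 0"
      by (metis emeasure_eq_0 null_setsD1 null_setsD2)
    then show "has_minkowski_content d K (emeasure \<mu>' K)"
      using assms(4) K(1) KS em[OF K(2)] by (auto simp: minkowski_content_measure_def)
  qed
  with S' sets' show ?thesis
    by (auto simp: minkowski_content_measure_def)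
qed

end
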